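(* Let $\lambda>1$ and let $D_U,D_V$ be the $n\times n$ symmetric matrices $D_U=W_2^{-1}-W_2^{-1}B-B^TW_2^{-1}+B^TW_2^{-1}B$, $D_V=W_1^{-1}-A^TW_1^{-1}-W_1^{-1}A$, where $A=K_V^0(I+\Sigma_2)^{-1}$, $W_1=K_V^0-K_V^0(I+\Sigma_2)^{-1}K_V^0$, $B=K_U^0(K_U^0+\Sigma_1)^{-1}$, $W_2=K_U^0-K_U^0(K_U^0+\Sigma_1)^{-1}K_U^0$ for given symmetric positive definite $K_U^0,K_V^0,\Sigma_1,\Sigma_2$ with $K_U^0+K_V^0=I$. Consider the problem $$(\mathrm P)\quad\max_{\tilde q}\ \int\tilde q(u)\Big(-\tfrac12u^TD_Uu-\ln\tilde q(u)\Big)du+\lambda\int\tilde q(v)\Big(-\tfrac12v^TD_Vv-\ln\tilde q(v)\Big)dv\quad\text{s.t. } \mathbb E_{\tilde q(u,v)}[UU^T+VV^T]=I$$ over joint pdfs $\tilde q(u,v)$. Suppose an optimal solution of $(\mathrm P)$ has marginals $U\sim\mathcal N(0,K_U)$, $V\sim\mathcal N(0,K_V)$ with $K_U,K_V\succ0$ and $K_U+K_V=I$. Then $K_U$ is optimal for $$\max_{K_U}\ -\mathrm{tr}(D_UK_U)-\lambda\,\mathrm{tr}(D_V(I-K_U))+\ln|K_U|+\lambda\ln|I-K_U|\quad\text{s.t. } 0\prec K_U\prec I.$$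
   Context: $|M|$ denotes the determinant; $0\prec K_U\prec I$ means $K_U$ and $I-K_U$ are positive definite. *)

theory Defs
  imports "HOL-Analysis.Analysis"
begin

text \<open>Positive definiteness of a real square matrix (includes symmetry).\<close>
definition posdef :: "real^'n^'n \<Rightarrow> bool" where
  "posdef M \<longleftrightarrow> transpose M = M \<and> (\<forall>x. x \<noteq> 0 \<longrightarrow> x \<bullet> (M *v x) > 0)"

text \<open>Joint probability density function of (U,V) on R^n x R^n (w.r.t. Lebesgue measure).\<close>
definition joint_pdf :: "((real^'n) \<times> (real^'n) \<Rightarrow> real) \<Rightarrow> bool" where
  "joint_pdf q \<longleftrightarrow> q \<in> borel_measurable (lborel \<Otimes>\<^sub>M lborel) \<and> (\<forall>x. 0 \<le> q x)
     \<and> integrable (lborel \<Otimes>\<^sub>M lborel) q \<and> integral\<^sup>L (lborel \<Otimes>\<^sub>M lborel) q = 1"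

text \<open>Marginal densities of U and V.\<close>
definition margU :: "((real^'n) \<times> (real^'n) \<Rightarrow> real) \<Rightarrow> real^'n \<Rightarrow> real" where
  "margU q u = (\<integral>v. q (u, v) \<partial>lborel)"

definition margV :: "((real^'n) \<times> (real^'n) \<Rightarrow> real) \<Rightarrow> real^'n \<Rightarrow> real" where
  "margV q v = (\<integral>u. q (u, v) \<partial>lborel)"

text \<open>Integrand p(u) (-1/2 u^T D u - ln p(u)).\<close>
definition ent_integrand :: "real^'n^'n \<Rightarrow> (real^'n \<Rightarrow> real) \<Rightarrow> real^'n \<Rightarrow> real" where
  "ent_integrand D p u = p u * (- (1/2) * (u \<bullet> (D *v u)) - ln (p u))"

text \<open>Objective of problem (P).\<close>
definition objP :: "real^'n^'n \<Rightarrow> real^'n^'n \<Rightarrow> real \<Rightarrow> ((real^'n) \<times> (real^'n) \<Rightarrow> real) \<Rightarrow> real" where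
  "objP DU DV lam q = (\<integral>u. ent_integrand DU (margU q) u \<partial>lborel)
                      + lam * (\<integral>v. ent_integrand DV (margV q) v \<partial>lborel)"

text \<open>Feasible points of (P): joint pdfs for which the objective integrals exist and
  E[U U^T + V V^T] = I.\<close>
definition feasibleP :: "real^'n^'n \<Rightarrow> real^'n^'n \<Rightarrow> ((real^'n) \<times> (real^'n) \<Rightarrow> real) \<Rightarrow> bool" where
  "feasibleP DU DV q \<longleftrightarrow> joint_pdf q
     \<and> integrable lborel (ent_integrand DU (margU q))
     \<and> integrable lborel (ent_integrand DV (margV q))
     \<and> (\<forall>i j. integrable (lborel \<Otimes>\<^sub>M lborel) (\<lambda>(u,v). q (u,v) * (u$i * u$j + v$i * v$j))
        \<and> (\<integral>(u,v). q (u,v) * (u$i * u$j + v$i * v$j) \<partial>(lborel \<Otimes>\<^sub>M lborel)) = (if i = j then 1 else 0))"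

definition optimalP :: "real^'n^'n \<Rightarrow> real^'n^'n \<Rightarrow> real \<Rightarrow> ((real^'n) \<times> (real^'n) \<Rightarrow> real) \<Rightarrow> bool" where
  "optimalP DU DV lam q \<longleftrightarrow> feasibleP DU DV q
     \<and> (\<forall>q'. feasibleP DU DV q' \<longrightarrow> objP DU DV lam q' \<le> objP DU DV lam q)"

text \<open>Density of the centred Gaussian N(0,K) on R^n.\<close>
definition gaussian_pdf :: "real^'n^'n \<Rightarrow> real^'n \<Rightarrow> real" where
  "gaussian_pdf K u = exp (- (1/2) * (u \<bullet> (matrix_inv K *v u)))
                       / sqrt ((2 * pi) ^ CARD('n) * det K)"

text \<open>Objective of the matrix problem.\<close>
definition objK :: "real^'n^'n \<Rightarrow> real^'n^'n \<Rightarrow> real \<Rightarrow> real^'n^'n \<Rightarrow> real" where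
  "objK DU DV lam K = - trace (DU ** K) - lam * trace (DV ** (mat 1 - K))
                      + ln (det K) + lam * ln (det (mat 1 - K))"

end

(*
  For every 0 < K < I the product density N(0,K)(u) N(0,I-K)(v) is feasible for (P), and for a
  feasible density whose marginals are N(0,K) and N(0,I-K) the objective of (P) equals
  objK(K)/2 + (1 + lam) n (1 + ln (2 pi))/2, since E[U^T D U] = tr(D K) and the differential entropy
  of N(0,K) is (ln |K| + n (1 + ln (2 pi)))/2. Comparing the optimal density with these product
  densities therefore compares objK(KU) with objK(K).

  The Gaussian integrals are reduced to the standard normal density by the substitution u = R z
  with R R^T = K, where R is obtained by Gram-Schmidt orthonormalisation for the inner product
  given by K.
*)

theory Submission
  imports Defs "HOL-Probability.Distributions"
begin

section \<open>Linear change of variables for Lebesgue measure on real^'n\<close>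

lemma linear_borel_measurable:
  fixes f :: "'a::euclidean_space \<Rightarrow> 'b::euclidean_space"
  assumes "linear f"
  shows "f \<in> borel_measurable borel"
  using assms by (intro borel_measurable_continuous_onI linear_continuous_on linear_conv_bounded_linear[THEN iffD1])

lemma prod_Basis_vec:
  "(\<Prod>b\<in>(Basis :: (real^'n) set). g b) = (\<Prod>i\<in>UNIV. g (axis i (1::real)))"
  by (simp add: Basis_vec_def prod.reindex inj_on_def axis_eq_axis UNION_singleton_eq_range)

text \<open>The library's linear change of variables (\<open>Change_Of_Vars\<close>) assumes a wellordered index
  type; here it is re-proved for any finite index type by factoring into elementary matrices.\<close>

definition lborel_change_vars :: "(real^'n::finite \<Rightarrow> real^'n) \<Rightarrow> bool" where
  "lborel_change_vars f \<longleftrightarrow> (\<forall>h \<in> borel_measurable borel.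
     (\<integral>\<^sup>+x. h (f x) * ennreal \<bar>det (matrix f)\<bar> \<partial>lborel) = (\<integral>\<^sup>+x. h x \<partial>lborel))"

lemma lborel_change_vars_comp:
  assumes "linear f" "linear g" "lborel_change_vars f" "lborel_change_vars g"
  shows "lborel_change_vars (f \<circ> g)"
  unfolding lborel_change_vars_def
proof
  fix h :: "real^'a \<Rightarrow> ennreal" assume h[measurable]: "h \<in> borel_measurable borel"
  have [measurable]: "f \<in> borel_measurable borel"
    using assms(1) by (rule linear_borel_measurable)
  have "(\<integral>\<^sup>+x. h ((f \<circ> g) x) * ennreal \<bar>det (matrix (f \<circ> g))\<bar> \<partial>lborel)
      = (\<integral>\<^sup>+x. (h (f (g x)) * ennreal \<bar>det (matrix f)\<bar>) * ennreal \<bar>det (matrix g)\<bar> \<partial>lborel)"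
    by (simp add: matrix_compose[OF assms(2,1)] det_mul abs_mult ennreal_mult mult.assoc)
  also have "\<dots> = (\<integral>\<^sup>+y. h (f y) * ennreal \<bar>det (matrix f)\<bar> \<partial>lborel)"
    using assms(4) unfolding lborel_change_vars_def by (rule bspec) measurable
  also have "\<dots> = (\<integral>\<^sup>+x. h x \<partial>lborel)"
    using assms(3) h by (simp add: lborel_change_vars_def)
  finally show "(\<integral>\<^sup>+x. h ((f \<circ> g) x) * ennreal \<bar>det (matrix (f \<circ> g))\<bar> \<partial>lborel) = (\<integral>\<^sup>+x. h x \<partial>lborel)" .
qed

lemma det_matrix_scale_coordinates:
  "det (matrix (\<lambda>x::real^'n::finite. \<chi> i. c i * x$i)) = (\<Prod>i\<in>UNIV. c i)"
proof -
  have "matrix (\<lambda>x::real^'n. \<chi> i. c i * x$i) = (\<chi> i j. if i = j then c i else 0)"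
    by (simp add: matrix_def vec_eq_iff axis_def)
  then show ?thesis
    by (simp add: det_diagonal)
qed

lemma lborel_change_vars_scale:
  fixes c :: "'n::finite \<Rightarrow> real"
  assumes "\<And>i. c i \<noteq> 0"
  shows "lborel_change_vars (\<lambda>x::real^'n. \<chi> i. c i * x$i)"
  unfolding lborel_change_vars_def
proof
  fix h :: "real^'n \<Rightarrow> ennreal" assume [measurable]: "h \<in> borel_measurable borel"
  have [measurable]: "(\<lambda>x::real^'n. \<chi> i. c i * x$i) \<in> borel_measurable borel"
    by (intro linear_borel_measurable linearI) (auto simp: vec_eq_iff algebra_simps)
  have "lborel = density (distr lborel borel (\<lambda>x::real^'n. 0 + (\<Sum>j\<in>Basis. (c (axis_index j) * (x \<bullet> j)) *\<^sub>R j)))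
      (\<lambda>_. \<Prod>j\<in>(Basis :: (real^'n) set). \<bar>c (axis_index j)\<bar>)"
    by (rule lborel_affine_euclidean[where c="\<lambda>j. c (axis_index j)" and t=0]) (use assms in simp)
  also have "(\<lambda>x::real^'n. 0 + (\<Sum>j\<in>Basis. (c (axis_index j) * (x \<bullet> j)) *\<^sub>R j)) = (\<lambda>x. \<chi> i. c i * x$i)"
    using vec_lambda_eq_sum[of "\<lambda>k y. c k * y"] by simp
  also have "(\<Prod>j\<in>(Basis :: (real^'n) set). \<bar>c (axis_index j)\<bar>) = \<bar>\<Prod>i\<in>UNIV. c i\<bar>"
    by (simp add: prod_Basis_vec abs_prod)
  finally have "lborel = density (distr lborel borel (\<lambda>x::real^'n. \<chi> i. c i * x$i)) (\<lambda>_. \<bar>\<Prod>i\<in>UNIV. c i\<bar>)" .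
  then have "(\<integral>\<^sup>+x. h x \<partial>lborel) = (\<integral>\<^sup>+x. h x \<partial>density (distr lborel borel (\<lambda>x::real^'n. \<chi> i. c i * x$i)) (\<lambda>_. \<bar>\<Prod>i\<in>UNIV. c i\<bar>))"
    by simp
  also have "\<dots> = (\<integral>\<^sup>+x. h (\<chi> i. c i * x$i) * ennreal \<bar>\<Prod>i\<in>UNIV. c i\<bar> \<partial>lborel)"
    by (simp add: nn_integral_density nn_integral_distr mult.commute)
  finally show "(\<integral>\<^sup>+x. h (\<chi> i. c i * x$i) * ennreal \<bar>det (matrix (\<lambda>x::real^'n. \<chi> i. c i * x$i))\<bar> \<partial>lborel) = (\<integral>\<^sup>+x. h x \<partial>lborel)"
    by (simp add: det_matrix_scale_coordinates)
qed

lemma lborel_distr_permute_coordinates: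
  assumes p: "p permutes (UNIV :: 'n::finite set)"
  shows "distr lborel borel (\<lambda>x::real^'n. \<chi> i. x $ p i) = lborel"
proof (rule lborel_eqI[symmetric])
  have [measurable]: "(\<lambda>x::real^'n. \<chi> i. x $ p i) \<in> borel_measurable borel"
    by (intro linear_borel_measurable linearI) (auto simp: vec_eq_iff)
  fix l u :: "real^'n" assume le: "\<And>b. b \<in> Basis \<Longrightarrow> l \<bullet> b \<le> u \<bullet> b"
  then have le': "l $ i \<le> u $ i" for i
    using le[of "axis i 1"] by (auto simp: Basis_vec_def inner_axis)
  have "(\<lambda>x::real^'n. \<chi> i. x $ p i) -` box l u = box (\<chi> i. l $ inv p i) (\<chi> i. u $ inv p i)"
    using permutes_inverses[OF p] by (auto simp: mem_box_cart) metis+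
  then have "emeasure (distr lborel borel (\<lambda>x::real^'n. \<chi> i. x $ p i)) (box l u)
      = emeasure lborel (box (\<chi> i. l $ inv p i) (\<chi> i. u $ inv p i) :: (real^'n) set)"
    by (simp add: emeasure_distr)
  also have "\<dots> = (\<Prod>i\<in>UNIV. ennreal (u $ inv p i - l $ inv p i))"
  proof -
    have "\<forall>b\<in>Basis. (\<chi> i. l $ inv p i) \<bullet> b \<le> (\<chi> i. u $ inv p i :: real^'n) \<bullet> b"
      using le' by (auto simp: Basis_vec_def inner_axis)
    then show ?thesis
      using le' by (simp add: emeasure_lborel_box_eq prod_Basis_vec inner_axis prod_ennreal)
  qed
  also have "\<dots> = (\<Prod>i\<in>UNIV. ennreal (u $ i - l $ i))"
    using prod.permute[OF permutes_inv[OF p], of "\<lambda>i. ennreal (u $ i - l $ i)"] by (simp add: o_def)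
  also have "\<dots> = (\<Prod>b\<in>Basis. (u - l) \<bullet> b)"
    using le' by (simp add: prod_Basis_vec inner_axis prod_ennreal)
  finally show "emeasure (distr lborel borel (\<lambda>x::real^'n. \<chi> i. x $ p i)) (box l u) = (\<Prod>b\<in>Basis. (u - l) \<bullet> b)" .
qed simp

lemma lborel_change_vars_swap: "lborel_change_vars (\<lambda>x::real^'n::finite. \<chi> i. x $ Transposition.transpose m n i)"
  unfolding lborel_change_vars_def
proof
  let ?p = "Transposition.transpose m n"
  fix h :: "real^'n \<Rightarrow> ennreal" assume [measurable]: "h \<in> borel_measurable borel"
  have p: "?p permutes UNIV" by (simp add: permutes_swap_id)
  have [measurable]: "(\<lambda>x::real^'n. \<chi> i. x $ ?p i) \<in> borel_measurable borel"
    by (intro linear_borel_measurable linearI) (auto simp: vec_eq_iff)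
  have "matrix (\<lambda>x::real^'n. \<chi> i. x $ ?p i) = (\<chi> i. (mat 1 :: real^'n^'n) $ ?p i)"
    by (simp add: matrix_def vec_eq_iff axis_def mat_def)
  then have "\<bar>det (matrix (\<lambda>x::real^'n. \<chi> i. x $ ?p i))\<bar> = 1"
    by (simp add: det_permute_rows[OF p] sign_def)
  moreover have "(\<integral>\<^sup>+x. h (\<chi> i. x $ ?p i) \<partial>lborel) = (\<integral>\<^sup>+x. h x \<partial>lborel)"
    by (subst lborel_distr_permute_coordinates[OF p, symmetric]) (simp add: nn_integral_distr)
  ultimately show "(\<integral>\<^sup>+x. h (\<chi> i. x $ ?p i) * ennreal \<bar>det (matrix (\<lambda>x::real^'n. \<chi> i. x $ ?p i))\<bar> \<partial>lborel)
      = (\<integral>\<^sup>+x. h x \<partial>lborel)"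
    by simp
qed

lemma nn_integral_lborel_along_Basis:
  fixes g :: "'a::euclidean_space \<Rightarrow> ennreal"
  assumes b: "b \<in> Basis" and [measurable]: "g \<in> borel_measurable borel"
  shows "(\<integral>\<^sup>+x. g x \<partial>lborel)
    = (\<integral>\<^sup>+x. (\<integral>\<^sup>+y. g ((\<Sum>c\<in>Basis - {b}. x c *\<^sub>R c) + y *\<^sub>R b) \<partial>lborel) \<partial>Pi\<^sub>M (Basis - {b}) (\<lambda>_. lborel))"
proof -
  interpret product_sigma_finite "\<lambda>_::'a. lborel::real measure"
    by standard
  have Basis: "Basis = insert b (Basis - {b})"
    using b by blast
  have split: "(\<Sum>c\<in>Basis. (x(b := y)) c *\<^sub>R c) = (\<Sum>c\<in>Basis - {b}. x c *\<^sub>R c) + y *\<^sub>R b" for x y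
  proof -
    have "(\<Sum>c\<in>Basis. (x(b := y)) c *\<^sub>R c) = y *\<^sub>R b + (\<Sum>c\<in>Basis - {b}. (x(b := y)) c *\<^sub>R c)"
      using b by (simp add: sum.remove)
    also have "(\<Sum>c\<in>Basis - {b}. (x(b := y)) c *\<^sub>R c) = (\<Sum>c\<in>Basis - {b}. x c *\<^sub>R c)"
      by (rule sum.cong) auto
    finally show ?thesis
      by (simp add: add.commute)
  qed
  have "(\<integral>\<^sup>+x. g x \<partial>lborel) = (\<integral>\<^sup>+x. g (\<Sum>c\<in>Basis. x c *\<^sub>R c) \<partial>Pi\<^sub>M Basis (\<lambda>_. lborel))"
    by (subst lborel_eq) (simp add: nn_integral_distr)
  also have "\<dots> = (\<integral>\<^sup>+x. (\<integral>\<^sup>+y. g (\<Sum>c\<in>Basis. (x(b := y)) c *\<^sub>R c) \<partial>lborel) \<partial>Pi\<^sub>M (Basis - {b}) (\<lambda>_. lborel))"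
    by (subst Basis, subst product_nn_integral_insert) (auto simp flip: Basis)
  finally show ?thesis
    by (simp only: split)
qed

lemma nn_integral_lborel_shear:
  fixes a b :: "'a::euclidean_space" and h :: "'a \<Rightarrow> ennreal"
  assumes b: "b \<in> Basis" and ab: "a \<bullet> b = 0" and [measurable]: "h \<in> borel_measurable borel"
  shows "(\<integral>\<^sup>+x. h (x + (a \<bullet> x) *\<^sub>R b) \<partial>lborel) = (\<integral>\<^sup>+x. h x \<partial>lborel)"
proof -
  have shear: "v + y *\<^sub>R b + (a \<bullet> (v + y *\<^sub>R b)) *\<^sub>R b = v + (a \<bullet> v + y) *\<^sub>R b" for v y
    using ab by (simp add: inner_add_right algebra_simps)
  have "(\<integral>\<^sup>+x. h (x + (a \<bullet> x) *\<^sub>R b) \<partial>lborel)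
      = (\<integral>\<^sup>+x. (\<integral>\<^sup>+y. h ((\<Sum>c\<in>Basis - {b}. x c *\<^sub>R c) + (a \<bullet> (\<Sum>c\<in>Basis - {b}. x c *\<^sub>R c) + y) *\<^sub>R b) \<partial>lborel)
          \<partial>Pi\<^sub>M (Basis - {b}) (\<lambda>_. lborel))"
    by (subst nn_integral_lborel_along_Basis[OF b], measurable) (simp only: shear)
  also have "\<dots> = (\<integral>\<^sup>+x. (\<integral>\<^sup>+y. h ((\<Sum>c\<in>Basis - {b}. x c *\<^sub>R c) + y *\<^sub>R b) \<partial>lborel) \<partial>Pi\<^sub>M (Basis - {b}) (\<lambda>_. lborel))"
  proof (rule nn_integral_cong)
    fix x :: "'a \<Rightarrow> real"
    let ?v = "\<Sum>c\<in>Basis - {b}. x c *\<^sub>R c"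
    show "(\<integral>\<^sup>+y. h (?v + (a \<bullet> ?v + y) *\<^sub>R b) \<partial>lborel) = (\<integral>\<^sup>+y. h (?v + y *\<^sub>R b) \<partial>lborel)"
      using nn_integral_real_affine[of "\<lambda>y. h (?v + y *\<^sub>R b)" 1 "a \<bullet> ?v"] by simp
  qed
  also have "\<dots> = (\<integral>\<^sup>+x. h x \<partial>lborel)"
    using b by (rule nn_integral_lborel_along_Basis[symmetric]) simp
  finally show ?thesis .
qed

lemma lborel_change_vars_shear:
  fixes m n :: "'n::finite"
  assumes mn: "m \<noteq> n"
  shows "lborel_change_vars (\<lambda>x::real^'n. \<chi> i. if i = m then x$m + x$n else x$i)"
  unfolding lborel_change_vars_def
proof
  let ?f = "\<lambda>x::real^'n. \<chi> i. if i = m then x$m + x$n else x$i"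
  fix h :: "real^'n \<Rightarrow> ennreal" assume [measurable]: "h \<in> borel_measurable borel"
  have "matrix ?f = (\<chi> k. if k = m then row m (mat 1) + 1 *s row n (mat 1) else row k (mat 1 :: real^'n^'n))"
    using mn by (simp add: matrix_def vec_eq_iff axis_def mat_def row_def)
  then have "det (matrix ?f) = 1"
    using mn by (simp add: det_row_operation)
  moreover have "?f x = x + (axis n 1 \<bullet> x) *\<^sub>R axis m 1" for x
    unfolding inner_axis' by (simp add: vec_eq_iff axis_def)
  moreover have "(\<integral>\<^sup>+x. h (x + (axis n 1 \<bullet> x) *\<^sub>R axis m 1) \<partial>lborel) = (\<integral>\<^sup>+x. h x \<partial>lborel)"
    using mn by (intro nn_integral_lborel_shear) (auto simp: Basis_vec_def inner_axis_axis)
  ultimately show "(\<integral>\<^sup>+x. h (?f x) * ennreal \<bar>det (matrix ?f)\<bar> \<partial>lborel) = (\<integral>\<^sup>+x. h x \<partial>lborel)"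
    by simp
qed

lemma lborel_change_vars_linear:
  fixes f :: "real^'n::finite \<Rightarrow> real^'n"
  assumes "linear f" "det (matrix f) \<noteq> 0"
  shows "lborel_change_vars f"
proof -
  have "det (matrix f) \<noteq> 0 \<longrightarrow> lborel_change_vars f"
  proof (rule induct_linear_elementary[where P="\<lambda>f. det (matrix f) \<noteq> 0 \<longrightarrow> lborel_change_vars f", OF assms(1)])
    fix f g :: "real^'n \<Rightarrow> real^'n"
    assume "linear f" "linear g" "det (matrix f) \<noteq> 0 \<longrightarrow> lborel_change_vars f" "det (matrix g) \<noteq> 0 \<longrightarrow> lborel_change_vars g"
    then show "det (matrix (f \<circ> g)) \<noteq> 0 \<longrightarrow> lborel_change_vars (f \<circ> g)"
      by (simp add: matrix_compose det_mul lborel_change_vars_comp)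
  next
    fix f :: "real^'n \<Rightarrow> real^'n" and i
    assume "linear f" "\<And>x. f x $ i = 0"
    then have "row i (matrix f) = 0"
      by (simp add: matrix_def row_def vec_eq_iff)
    then show "det (matrix f) \<noteq> 0 \<longrightarrow> lborel_change_vars f"
      by (metis det_zero_row row_def vec_lambda_eta)
  next
    fix c :: "'n \<Rightarrow> real"
    show "det (matrix (\<lambda>x::real^'n. \<chi> i. c i * x$i)) \<noteq> 0 \<longrightarrow> lborel_change_vars (\<lambda>x::real^'n. \<chi> i. c i * x$i)"
      by (auto simp: det_matrix_scale_coordinates intro: lborel_change_vars_scale)
  qed (use lborel_change_vars_swap lborel_change_vars_shear in blast)+
  with assms(2) show ?thesis by simp
qed

lemma nn_integral_lborel_linear:
  fixes f :: "real^'n::finite \<Rightarrow> real^'n"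
  assumes "linear f" "det (matrix f) \<noteq> 0" "h \<in> borel_measurable borel"
  shows "(\<integral>\<^sup>+x. h (f x) * ennreal \<bar>det (matrix f)\<bar> \<partial>lborel) = (\<integral>\<^sup>+x. h x \<partial>lborel)"
  using lborel_change_vars_linear[OF assms(1,2)] assms(3) by (simp add: lborel_change_vars_def)

section \<open>The standard Gaussian density on real^'n\<close>

lemma sum_Basis_vec:
  "(\<Sum>b\<in>(Basis :: (real^'n) set). g b) = (\<Sum>i\<in>UNIV. g (axis i (1::real)))"
  by (simp add: Basis_vec_def sum.reindex inj_on_def axis_eq_axis UNION_singleton_eq_range)

lemma sum_Basis_vec_nth: "(\<Sum>b\<in>(Basis::(real^'n::finite) set). F b *\<^sub>R b) $ i = F (axis i 1)"
  by (simp add: sum_Basis_vec axis_def if_distrib cong: if_cong)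

lemma
  fixes h :: "'n::finite \<Rightarrow> real \<Rightarrow> real"
  assumes int: "\<And>i. integrable lborel (h i)"
  shows integrable_lborel_prod_coordinates: "integrable lborel (\<lambda>z::real^'n. \<Prod>i\<in>UNIV. h i (z$i))"
    and integral_lborel_prod_coordinates:
      "(\<integral>z. (\<Prod>i\<in>UNIV. h i ((z::real^'n)$i)) \<partial>lborel) = (\<Prod>i\<in>UNIV. integral\<^sup>L lborel (h i))"
proof -
  interpret product_sigma_finite "\<lambda>_::real^'n. lborel::real measure"
    by standard
  have [measurable]: "\<And>i. h i \<in> borel_measurable borel"
    using int by (simp add: borel_measurable_integrable)
  define h' where "h' b = h (axis_index b)" for b :: "real^'n"
  have int': "\<And>b. integrable lborel (h' b)"
    using int by (simp add: h'_def)
  have Sum[measurable]: "(\<lambda>F. \<Sum>b\<in>(Basis::(real^'n) set). F b *\<^sub>R b) \<in> Pi\<^sub>M Basis (\<lambda>_. lborel) \<rightarrow>\<^sub>M borel"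
    by measurable
  have prod: "(\<Prod>i\<in>UNIV. h i ((\<Sum>b\<in>(Basis::(real^'n) set). F b *\<^sub>R b)$i)) = (\<Prod>b\<in>Basis. h' b (F b))" for F
    unfolding sum_Basis_vec_nth by (simp add: prod_Basis_vec h'_def)
  have "integrable (Pi\<^sub>M Basis (\<lambda>_. lborel)) (\<lambda>F. \<Prod>b\<in>(Basis::(real^'n) set). h' b (F b))"
    by (intro product_integrable_prod) (simp_all add: int')
  then show "integrable lborel (\<lambda>z::real^'n. \<Prod>i\<in>UNIV. h i (z$i))"
    by (subst lborel_eq, subst integrable_distr_eq[OF Sum]) (measurable, simp only: prod)
  have "(\<integral>z. (\<Prod>i\<in>UNIV. h i ((z::real^'n)$i)) \<partial>lborel) = (\<Prod>b\<in>(Basis::(real^'n) set). integral\<^sup>L lborel (h' b))"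
    by (subst lborel_eq, subst integral_distr[OF Sum], measurable)
      (simp only: prod product_integral_prod int' finite_Basis)
  then show "(\<integral>z. (\<Prod>i\<in>UNIV. h i ((z::real^'n)$i)) \<partial>lborel) = (\<Prod>i\<in>UNIV. integral\<^sup>L lborel (h i))"
    by (simp add: prod_Basis_vec h'_def)
qed

definition std_gaussian_pdf :: "real^'n::finite \<Rightarrow> real" where
  "std_gaussian_pdf z = (\<Prod>i\<in>UNIV. std_normal_density (z$i))"

lemma std_gaussian_pdf_pos: "std_gaussian_pdf z > 0"
  unfolding std_gaussian_pdf_def by (intro prod_pos) (simp add: std_normal_density_def)

lemma borel_measurable_std_gaussian_pdf [measurable]: "std_gaussian_pdf \<in> borel_measurable borel"
  unfolding std_gaussian_pdf_def by measurable

lemma std_gaussian_pdf_eq: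
  fixes z :: "real^'n::finite"
  shows "std_gaussian_pdf z = exp (- (z \<bullet> z) / 2) / sqrt (2 * pi) ^ CARD('n)"
proof -
  have "std_gaussian_pdf z = (\<Prod>i\<in>UNIV. exp (- ((z$i)^2) / 2)) / (\<Prod>i\<in>(UNIV::'n set). sqrt (2 * pi))"
    unfolding std_gaussian_pdf_def std_normal_density_def by (simp add: prod_dividef)
  also have "(\<Prod>i\<in>UNIV. exp (- ((z$i)^2) / 2)) = exp (- (z \<bullet> z) / 2)"
    by (simp add: exp_sum[symmetric] inner_vec_def power2_eq_square sum_divide_distrib sum_negf)
  finally show ?thesis
    by simp
qed

lemma integral_std_normal_moment_le_2:
  assumes "k \<le> 2"
  shows "(\<integral>t. std_normal_density t * t ^ k \<partial>lborel) = (if k = 1 then 0 else 1)"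
proof -
  have "k = 0 \<or> k = 1 \<or> k = 2"
    using assms by auto
  then show ?thesis
    using integral_std_normal_moment_even[of 0] integral_std_normal_moment_even[of 1]
      integral_std_normal_moment_odd[of 0] by auto
qed

lemma integrable_std_gaussian_pdf: "integrable lborel (std_gaussian_pdf :: real^'n::finite \<Rightarrow> real)"
  and integral_std_gaussian_pdf: "(\<integral>z. std_gaussian_pdf (z::real^'n::finite) \<partial>lborel) = 1"
  using integrable_lborel_prod_coordinates[of "\<lambda>_. std_normal_density"]
    integral_lborel_prod_coordinates[of "\<lambda>_. std_normal_density"]
    integrable_std_normal_moment[of 0] integral_std_normal_moment_le_2[of 0]
  by (simp_all add: std_gaussian_pdf_def[abs_def])

lemma
  fixes k l :: "'n::finite"
  shows integrable_std_gaussian_pdf_mult_coordinates: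
      "integrable lborel (\<lambda>z::real^'n. std_gaussian_pdf z * (z$k * z$l))"
    and integral_std_gaussian_pdf_mult_coordinates:
      "(\<integral>z. std_gaussian_pdf (z::real^'n) * (z$k * z$l) \<partial>lborel) = (if k = l then 1 else 0)"
proof -
  define e where "e i = (if i = k then 1 else 0) + (if i = l then 1 else (0::nat))" for i
  define h where "h i t = std_normal_density t * t ^ e i" for i t
  have int: "\<And>i. integrable lborel (h i)"
    unfolding h_def by (rule integrable_std_normal_moment)
  have prod: "(\<Prod>i\<in>UNIV. h i (z$i)) = std_gaussian_pdf z * (z$k * z$l)" for z :: "real^'n"
    by (simp add: h_def e_def std_gaussian_pdf_def prod.distrib power_add
        if_distrib[of "\<lambda>n. _ ^ n"] prod.delta cong: if_cong)
  show "integrable lborel (\<lambda>z::real^'n. std_gaussian_pdf z * (z$k * z$l))"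
    using integrable_lborel_prod_coordinates[of h, OF int] by (simp add: prod)
  have "(\<integral>z. std_gaussian_pdf (z::real^'n) * (z$k * z$l) \<partial>lborel) = (\<Prod>i\<in>UNIV. integral\<^sup>L lborel (h i))"
    using integral_lborel_prod_coordinates[of h, OF int] by (simp only: prod)
  also have "\<dots> = (\<Prod>i\<in>UNIV. if e i = 1 then 0 else 1)"
    unfolding h_def by (intro prod.cong refl integral_std_normal_moment_le_2) (simp add: e_def)
  also have "\<dots> = (if k = l then 1 else 0)"
  proof (cases "k = l")
    case True
    then have "e i \<noteq> 1" for i
      by (simp add: e_def)
    with True show ?thesis
      by simp
  next
    case False
    then have "e k = 1"
      by (simp add: e_def)
    with False show ?thesis
      by (subst prod_zero) auto
  qed
  finally show "(\<integral>z. std_gaussian_pdf (z::real^'n) * (z$k * z$l) \<partial>lborel) = (if k = l then 1 else 0)" .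
qed

section \<open>Positive definite matrices are congruent to the identity\<close>

lemma inner_matrix_vector_symmetric:
  fixes K :: "real^'n::finite^'n"
  assumes "transpose K = K"
  shows "x \<bullet> (K *v y) = y \<bullet> (K *v x)"
  by (metis assms dot_lmul_matrix inner_commute transpose_transpose vector_transpose_matrix)

lemma span_insert_eq_if_diff_in_span:
  fixes a b :: "'a::real_vector"
  assumes "c \<noteq> 0" "b - c *\<^sub>R a \<in> span S"
  shows "span (insert b S) = span (insert a S)"
proof -
  have "b \<in> span (insert a S)"
    using assms(2) unfolding span_breakdown_eq by blast
  moreover have "a - (1 / c) *\<^sub>R b = - (1 / c) *\<^sub>R (b - c *\<^sub>R a)"
    using assms(1) by (simp add: algebra_simps)
  then have "a \<in> span (insert b S)"
    using assms(2) unfolding span_breakdown_eq by (metis span_scale)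
  ultimately show ?thesis
    by (auto simp: span_eq intro: span_base span_mono[THEN subsetD, of S])
qed

definition orthonormal_wrt :: "real^'n::finite^'n \<Rightarrow> (real^'n) set \<Rightarrow> bool" where
  "orthonormal_wrt K C \<longleftrightarrow>
     (\<forall>c\<in>C. c \<bullet> (K *v c) = 1) \<and> (\<forall>c\<in>C. \<forall>d\<in>C. c \<noteq> d \<longrightarrow> c \<bullet> (K *v d) = 0)"

lemma orthonormal_wrt_insert:
  fixes K :: "real^'n::finite^'n"
  assumes K: "posdef K" and C: "finite C" "orthonormal_wrt K C" and x: "x \<notin> span C"
  obtains w where "orthonormal_wrt K (insert w C)" "span (insert w C) = span (insert x C)"
proof -
  have sym: "transpose K = K" and pos: "\<And>v. v \<noteq> 0 \<Longrightarrow> v \<bullet> (K *v v) > 0"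
    using K by (auto simp: posdef_def)
  define p where "p = (\<Sum>c\<in>C. (x \<bullet> (K *v c)) *\<^sub>R c)"
  define y where "y = x - p"
  have p: "p \<in> span C"
    unfolding p_def by (intro span_sum span_scale span_base)
  then have "y \<noteq> 0"
    using x by (auto simp: y_def)
  then have s: "y \<bullet> (K *v y) > 0"
    by (rule pos)
  have yd: "y \<bullet> (K *v d) = 0" if "d \<in> C" for d
  proof -
    have "(\<Sum>c\<in>C. (x \<bullet> (K *v c)) * (c \<bullet> (K *v d))) = (x \<bullet> (K *v d)) * (d \<bullet> (K *v d))"
      using that C by (subst sum.remove[of _ d]) (auto simp: orthonormal_wrt_def intro!: sum.neutral)
    then show ?thesis
      using that C by (simp add: y_def p_def orthonormal_wrt_def inner_diff_left inner_sum_left)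
  qed
  define w where "w = (1 / sqrt (y \<bullet> (K *v y))) *\<^sub>R y"
  have "w \<bullet> (K *v w) = 1"
    using s by (simp add: w_def matrix_vector_mult_scaleR real_sqrt_mult[symmetric] field_simps)
  moreover have "w \<bullet> (K *v d) = 0" "d \<bullet> (K *v w) = 0" if "d \<in> C" for d
    using yd[OF that] inner_matrix_vector_symmetric[OF sym, of d w] by (simp_all add: w_def)
  ultimately have "orthonormal_wrt K (insert w C)"
    using C by (auto simp: orthonormal_wrt_def)
  moreover have "span (insert w C) = span (insert y C)"
    using s by (intro span_insert_eq_if_diff_in_span[where c="1 / sqrt (y \<bullet> (K *v y))"]) (simp_all add: w_def span_zero)
  moreover have "span (insert y C) = span (insert x C)"
    using p by (intro span_insert_eq_if_diff_in_span[where c=1]) (simp_all add: y_def span_neg)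
  ultimately show thesis
    by (intro that[of w]) simp_all
qed

lemma orthonormal_wrt_spanning:
  fixes K :: "real^'n::finite^'n"
  assumes K: "posdef K" and "finite X"
  shows "\<exists>C. finite C \<and> span C = span X \<and> orthonormal_wrt K C"
  using assms(2)
proof (induction X rule: finite_induct)
  case empty
  show ?case
    by (auto simp: orthonormal_wrt_def)
next
  case (insert x X)
  then obtain C where C: "finite C" "span C = span X" "orthonormal_wrt K C"
    by blast
  have span_eq: "span (insert x C) = span (insert x X)"
    by (simp add: span_insert C(2))
  show ?case
  proof (cases "x \<in> span C")
    case True
    then show ?thesis
      using C span_eq by (metis span_redundant)
  next
    case False
    then obtain w where "orthonormal_wrt K (insert w C)" "span (insert w C) = span (insert x C)"
      using orthonormal_wrt_insert[OF K C(1,3)] by blast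
    then show ?thesis
      using C(1) span_eq by (metis finite_insert)
  qed
qed

lemma posdef_congruent_mat_1:
  fixes K :: "real^'n::finite^'n"
  assumes K: "posdef K"
  obtains T :: "real^'n^'n" where "T ** K ** transpose T = mat 1"
proof -
  obtain C where C: "finite C" "span C = UNIV" "orthonormal_wrt K C"
    using orthonormal_wrt_spanning[OF K, of Basis] by auto
  have "CARD('n) \<le> card C"
    using C dim_le_card[of UNIV C] by simp
  then obtain g :: "'n \<Rightarrow> real^'n" where g: "range g \<subseteq> C" "inj g"
    using card_le_inj[of "UNIV :: 'n set" C] C(1) by auto
  define T :: "real^'n^'n" where "T = (\<chi> i. g i)"
  have "(T ** K ** transpose T) $ i $ j = g i \<bullet> (K *v g j)" for i j
    by (simp add: T_def matrix_matrix_mult_def matrix_vector_mult_def inner_vec_def transpose_def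
        sum_distrib_left sum_distrib_right mult_ac) (rule sum.swap)
  also have "g i \<bullet> (K *v g j) = (if i = j then 1 else 0)" for i j
    using g C(3) unfolding orthonormal_wrt_def by (metis inj_eq range_subsetD)
  finally show thesis
    by (intro that[of T]) (simp add: vec_eq_iff mat_def)
qed

section \<open>Centred Gaussian densities\<close>

lemma matrix_inv_invertible:
  fixes A :: "real^'n::finite^'n"
  assumes "invertible A"
  shows "A ** matrix_inv A = mat 1" "matrix_inv A ** A = mat 1"
  using someI_ex[OF assms[unfolded invertible_def]] by (simp_all add: matrix_inv_def)

lemma matrix_inv_eqI:
  fixes A X :: "real^'n::finite^'n"
  assumes "A ** X = mat 1"
  shows "matrix_inv A = X"
proof -
  have "invertible A"
    using assms matrix_left_right_inverse by (auto simp: invertible_def)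
  then have "matrix_inv A = matrix_inv A ** (A ** X)"
    by (simp add: assms)
  also have "\<dots> = X"
    using matrix_inv_invertible[OF \<open>invertible A\<close>] by (simp add: matrix_mul_assoc)
  finally show ?thesis .
qed

lemma det_mult_det_square_eq_1:
  fixes K T :: "real^'n::finite^'n"
  assumes "T ** K ** transpose T = mat 1"
  shows "det K * (det T)^2 = 1"
  using arg_cong[OF assms, of det] by (simp add: det_mul power2_eq_square mult_ac)

lemma posdef_det_pos:
  fixes K :: "real^'n::finite^'n"
  assumes "posdef K"
  shows "det K > 0"
proof -
  obtain T :: "real^'n^'n" where "T ** K ** transpose T = mat 1"
    using posdef_congruent_mat_1[OF assms] .
  from det_mult_det_square_eq_1[OF this] show ?thesis
    by (metis not_one_le_zero mult_nonpos_nonneg not_less zero_le_power2)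
qed

lemma posdef_matrix_inv:
  fixes K :: "real^'n::finite^'n"
  assumes "posdef K"
  shows "matrix_inv K ** K = mat 1"
  using posdef_det_pos[OF assms] by (simp add: matrix_inv_invertible invertible_det_nz)

lemma gaussian_pdf_eq_std_gaussian_pdf:
  fixes K T :: "real^'n::finite^'n"
  assumes TKT: "T ** K ** transpose T = mat 1"
  shows "gaussian_pdf K u = \<bar>det T\<bar> * std_gaussian_pdf (T *v u)"
proof -
  have det: "det K * (det T)^2 = 1"
    using det_mult_det_square_eq_1[OF TKT] .
  then have "invertible T"
    by (auto simp: invertible_det_nz)
  then have "K ** (transpose T ** T) = matrix_inv T ** (T ** K ** transpose T) ** T"
    by (simp add: matrix_mul_assoc matrix_inv_invertible)
  then have "matrix_inv K = transpose T ** T"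
    using \<open>invertible T\<close> by (intro matrix_inv_eqI) (simp add: TKT matrix_inv_invertible)
  then have quad: "u \<bullet> (matrix_inv K *v u) = (T *v u) \<bullet> (T *v u)"
    by (simp add: matrix_vector_mul_assoc[symmetric] dot_lmul_matrix[symmetric] vector_transpose_matrix inner_commute)
  have "sqrt (det K) * \<bar>det T\<bar> = 1"
    using arg_cong[OF det, of sqrt] by (simp add: real_sqrt_mult)
  then have "sqrt (det K) = 1 / \<bar>det T\<bar>"
    by (auto simp: eq_divide_eq)
  then have "sqrt ((2 * pi) ^ CARD('n) * det K) = sqrt (2 * pi) ^ CARD('n) / \<bar>det T\<bar>"
    by (simp add: real_sqrt_mult real_sqrt_power power_mult_distrib)
  then show ?thesis
    using det by (auto simp: gaussian_pdf_def std_gaussian_pdf_eq quad)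
qed

lemma
  fixes K :: "real^'n::finite^'n"
  assumes "posdef K"
  shows gaussian_pdf_pos: "gaussian_pdf K u > 0"
    and borel_measurable_gaussian_pdf [measurable]: "gaussian_pdf K \<in> borel_measurable borel"
proof -
  obtain T :: "real^'n^'n" where TKT: "T ** K ** transpose T = mat 1"
    using posdef_congruent_mat_1[OF assms] .
  then have "det T \<noteq> 0"
    using det_mult_det_square_eq_1 by fastforce
  then show "gaussian_pdf K u > 0"
    by (simp add: gaussian_pdf_eq_std_gaussian_pdf[OF TKT] std_gaussian_pdf_pos)
  have [measurable]: "(\<lambda>u. T *v u) \<in> borel_measurable borel"
    by (intro linear_borel_measurable matrix_vector_mul_linear)
  show "gaussian_pdf K \<in> borel_measurable borel"
    by (simp add: gaussian_pdf_eq_std_gaussian_pdf[OF TKT, abs_def])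
qed

lemma density_gaussian_pdf:
  fixes K T R :: "real^'n::finite^'n"
  assumes TKT: "T ** K ** transpose T = mat 1" and TR: "T ** R = mat 1"
  shows "density lborel (gaussian_pdf K) = distr (density lborel std_gaussian_pdf) borel (\<lambda>z. R *v z)"
proof (rule measure_eqI)
  fix A assume "A \<in> sets (density lborel (gaussian_pdf K))"
  then have [measurable]: "A \<in> sets borel"
    by simp
  have [measurable]: "(\<lambda>z. R *v z) \<in> borel_measurable borel" "(\<lambda>z. T *v z) \<in> borel_measurable borel"
    by (intro linear_borel_measurable matrix_vector_mul_linear)+
  have "det T \<noteq> 0"
    using det_mult_det_square_eq_1[OF TKT] by auto
  have "R ** T = mat 1"
    using TR matrix_left_right_inverse by blast
  then have RT: "R *v (T *v u) = u" for u
    by (simp add: matrix_vector_mul_assoc)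
  have "emeasure (density lborel (gaussian_pdf K)) A
      = (\<integral>\<^sup>+u. ennreal (std_gaussian_pdf (T *v u)) * indicator A (R *v (T *v u)) * ennreal \<bar>det (matrix ((*v) T))\<bar> \<partial>lborel)"
    by (subst emeasure_density) (auto simp: gaussian_pdf_eq_std_gaussian_pdf[OF TKT] RT ennreal_mult' mult_ac)
  also have "\<dots> = (\<integral>\<^sup>+z. ennreal (std_gaussian_pdf z) * indicator A (R *v z) \<partial>lborel)"
    using \<open>det T \<noteq> 0\<close> by (intro nn_integral_lborel_linear) simp_all
  also have "\<dots> = emeasure (distr (density lborel std_gaussian_pdf) borel (\<lambda>z. R *v z)) A"
  proof -
    have "(\<lambda>z. R *v z) -` A \<in> sets borel"
      by (rule measurable_sets_borel) measurable
    then show ?thesis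
      by (simp add: emeasure_distr emeasure_density indicator_vimage[symmetric] mult.commute)
  qed
  finally show "emeasure (density lborel (gaussian_pdf K)) A = emeasure (distr (density lborel std_gaussian_pdf) borel (\<lambda>z. R *v z)) A" .
qed simp

lemma posdef_factor:
  fixes K :: "real^'n::finite^'n"
  assumes "posdef K"
  obtains T R :: "real^'n^'n"
  where "T ** K ** transpose T = mat 1" "T ** R = mat 1" "R ** transpose R = K"
proof -
  obtain T :: "real^'n^'n" where TKT: "T ** K ** transpose T = mat 1"
    using posdef_congruent_mat_1[OF assms] .
  then have "invertible T"
    using det_mult_det_square_eq_1 by (fastforce simp: invertible_det_nz)
  define R where "R = matrix_inv T"
  have TR: "T ** R = mat 1" "R ** T = mat 1"
    using matrix_inv_invertible[OF \<open>invertible T\<close>] by (simp_all add: R_def)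
  have "K = (R ** T) ** K ** transpose (R ** T)"
    by (simp add: TR)
  also have "\<dots> = R ** (T ** K ** transpose T) ** transpose R"
    by (simp add: matrix_mul_assoc matrix_transpose_mul)
  finally have "R ** transpose R = K"
    by (simp add: TKT)
  with TKT TR(1) show thesis
    by (rule that)
qed

lemma gaussian_pdf_change_variables:
  fixes K :: "real^'n::finite^'n"
  assumes K: "posdef K"
  obtains R :: "real^'n^'n" where "R ** transpose R = K"
    and "\<And>f. f \<in> borel_measurable borel \<Longrightarrow>
      integrable lborel (\<lambda>u. gaussian_pdf K u * f u) \<longleftrightarrow> integrable lborel (\<lambda>z. std_gaussian_pdf z * f (R *v z))"
    and "\<And>f. f \<in> borel_measurable borel \<Longrightarrow>
      (\<integral>u. gaussian_pdf K u * f u \<partial>lborel) = (\<integral>z. std_gaussian_pdf z * f (R *v z) \<partial>lborel)"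
proof -
  obtain T R :: "real^'n^'n" where TKT: "T ** K ** transpose T = mat 1" and TR: "T ** R = mat 1"
    and RRK: "R ** transpose R = K"
    using posdef_factor[OF K] .
  have M: "density lborel (gaussian_pdf K) = distr (density lborel std_gaussian_pdf) borel (\<lambda>z. R *v z)"
    by (rule density_gaussian_pdf[OF TKT TR])
  have [measurable]: "(\<lambda>z. R *v z) \<in> borel_measurable borel"
    by (intro linear_borel_measurable matrix_vector_mul_linear)
  have [measurable]: "gaussian_pdf K \<in> borel_measurable borel"
    using K by (rule borel_measurable_gaussian_pdf)
  have nonneg: "\<And>u. 0 \<le> gaussian_pdf K u" "\<And>z. 0 \<le> std_gaussian_pdf z"
    using gaussian_pdf_pos[OF K] std_gaussian_pdf_pos by (auto intro: less_imp_le)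
  show thesis
  proof (rule that[OF RRK])
    fix f :: "real^'n \<Rightarrow> real" assume [measurable]: "f \<in> borel_measurable borel"
    have "integrable lborel (\<lambda>u. gaussian_pdf K u * f u) \<longleftrightarrow> integrable (density lborel (gaussian_pdf K)) f"
      using nonneg by (subst integrable_density) auto
    also have "\<dots> \<longleftrightarrow> integrable (density lborel std_gaussian_pdf) (\<lambda>z. f (R *v z))"
      unfolding M by (rule integrable_distr_eq) measurable
    also have "\<dots> \<longleftrightarrow> integrable lborel (\<lambda>z. std_gaussian_pdf z * f (R *v z))"
      using nonneg by (subst integrable_density) auto
    finally show "integrable lborel (\<lambda>u. gaussian_pdf K u * f u) \<longleftrightarrow> integrable lborel (\<lambda>z. std_gaussian_pdf z * f (R *v z))" .
    have "(\<integral>u. gaussian_pdf K u * f u \<partial>lborel) = integral\<^sup>L (density lborel (gaussian_pdf K)) f"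
      using nonneg by (subst integral_density) auto
    also have "\<dots> = integral\<^sup>L (density lborel std_gaussian_pdf) (\<lambda>z. f (R *v z))"
      unfolding M by (rule integral_distr) measurable
    also have "\<dots> = (\<integral>z. std_gaussian_pdf z * f (R *v z) \<partial>lborel)"
      using nonneg by (subst integral_density) auto
    finally show "(\<integral>u. gaussian_pdf K u * f u \<partial>lborel) = (\<integral>z. std_gaussian_pdf z * f (R *v z) \<partial>lborel)" .
  qed
qed

lemma
  fixes K :: "real^'n::finite^'n"
  assumes "posdef K"
  shows integrable_gaussian_pdf: "integrable lborel (gaussian_pdf K)"
    and integral_gaussian_pdf: "integral\<^sup>L lborel (gaussian_pdf K) = 1"
    and integrable_gaussian_pdf_mult_coordinates:
      "integrable lborel (\<lambda>u. gaussian_pdf K u * (u$i * u$j))"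
    and integral_gaussian_pdf_mult_coordinates:
      "(\<integral>u. gaussian_pdf K u * (u$i * u$j) \<partial>lborel) = K$i$j"
proof -
  obtain R :: "real^'n^'n" where RRK: "R ** transpose R = K"
    and int: "\<And>f. f \<in> borel_measurable borel \<Longrightarrow>
      integrable lborel (\<lambda>u. gaussian_pdf K u * f u) \<longleftrightarrow> integrable lborel (\<lambda>z. std_gaussian_pdf z * f (R *v z))"
    and eq: "\<And>f. f \<in> borel_measurable borel \<Longrightarrow>
      (\<integral>u. gaussian_pdf K u * f u \<partial>lborel) = (\<integral>z. std_gaussian_pdf z * f (R *v z) \<partial>lborel)"
    using gaussian_pdf_change_variables[OF assms] by blast
  from int[of "\<lambda>_. 1"] eq[of "\<lambda>_. 1"]
  show "integrable lborel (gaussian_pdf K)" "integral\<^sup>L lborel (gaussian_pdf K) = 1"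
    by (simp_all add: integrable_std_gaussian_pdf integral_std_gaussian_pdf)
  have expand: "std_gaussian_pdf z * ((R *v z)$i * (R *v z)$j)
      = (\<Sum>k\<in>UNIV. \<Sum>l\<in>UNIV. (R$j$k * R$i$l) * (std_gaussian_pdf z * (z$k * z$l)))" for z
    by (simp add: matrix_vector_mult_def sum_product sum_distrib_left mult_ac)
  have "integrable lborel (\<lambda>z. \<Sum>k\<in>UNIV. \<Sum>l\<in>UNIV. (R$j$k * R$i$l) * (std_gaussian_pdf z * (z$k * z$l)))"
    by (intro Bochner_Integration.integrable_sum integrable_mult_right integrable_std_gaussian_pdf_mult_coordinates)
  then show "integrable lborel (\<lambda>u. gaussian_pdf K u * (u$i * u$j))"
    by (subst int) (auto simp: expand)
  have "(\<integral>u. gaussian_pdf K u * (u$i * u$j) \<partial>lborel)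
      = (\<integral>z. (\<Sum>k\<in>UNIV. \<Sum>l\<in>UNIV. (R$j$k * R$i$l) * (std_gaussian_pdf z * (z$k * z$l))) \<partial>lborel)"
    by (subst eq) (auto simp: expand)
  also have "\<dots> = (\<Sum>k\<in>UNIV. \<Sum>l\<in>UNIV. (R$j$k * R$i$l) * (if k = l then 1 else 0))"
    by (simp add: Bochner_Integration.integral_sum Bochner_Integration.integrable_sum
        integrable_std_gaussian_pdf_mult_coordinates integral_std_gaussian_pdf_mult_coordinates)
  also have "\<dots> = (R ** transpose R) $ i $ j"
    by (simp add: matrix_matrix_mult_def transpose_def mult_delta_left mult_delta_right mult.commute)
  finally show "(\<integral>u. gaussian_pdf K u * (u$i * u$j) \<partial>lborel) = K$i$j"
    by (simp add: RRK)
qed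

lemma
  fixes K D :: "real^'n::finite^'n"
  assumes K: "posdef K"
  shows integrable_gaussian_pdf_quadratic_form:
      "integrable lborel (\<lambda>u. gaussian_pdf K u * (u \<bullet> (D *v u)))"
    and integral_gaussian_pdf_quadratic_form:
      "(\<integral>u. gaussian_pdf K u * (u \<bullet> (D *v u)) \<partial>lborel) = trace (D ** K)"
proof -
  have expand: "gaussian_pdf K u * (u \<bullet> (D *v u)) = (\<Sum>i\<in>UNIV. \<Sum>j\<in>UNIV. D$i$j * (gaussian_pdf K u * (u$i * u$j)))" for u
    by (simp add: inner_vec_def matrix_vector_mult_def sum_distrib_left mult_ac)
  show "integrable lborel (\<lambda>u. gaussian_pdf K u * (u \<bullet> (D *v u)))"
    unfolding expand
    by (intro Bochner_Integration.integrable_sum integrable_mult_right integrable_gaussian_pdf_mult_coordinates K)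
  have "(\<integral>u. gaussian_pdf K u * (u \<bullet> (D *v u)) \<partial>lborel) = (\<Sum>i\<in>UNIV. \<Sum>j\<in>UNIV. D$i$j * K$i$j)"
    unfolding expand
    by (simp add: Bochner_Integration.integral_sum Bochner_Integration.integrable_sum K
        integrable_gaussian_pdf_mult_coordinates integral_gaussian_pdf_mult_coordinates)
  also have "\<dots> = trace (D ** K)"
  proof -
    have "transpose K = K"
      using K by (simp add: posdef_def)
    have "K$j$i = K$i$j" for i j
      by (subst (2) \<open>transpose K = K\<close>[symmetric]) (simp only: transpose_def vec_lambda_beta)
    then show ?thesis
      by (simp add: trace_def matrix_matrix_mult_def)
  qed
  finally show "(\<integral>u. gaussian_pdf K u * (u \<bullet> (D *v u)) \<partial>lborel) = trace (D ** K)" .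
qed

lemma
  fixes K D :: "real^'n::finite^'n"
  assumes K: "posdef K"
  shows integrable_ent_integrand_gaussian_pdf: "integrable lborel (ent_integrand D (gaussian_pdf K))"
    and integral_ent_integrand_gaussian_pdf: "integral\<^sup>L lborel (ent_integrand D (gaussian_pdf K))
      = (- trace (D ** K) + ln (det K)) / 2 + real CARD('n) / 2 * (1 + ln (2 * pi))"
proof -
  define c where "c = sqrt ((2 * pi) ^ CARD('n) * det K)"
  have "c > 0"
    using posdef_det_pos[OF K] by (simp add: c_def)
  have "gaussian_pdf K u = exp (- (u \<bullet> (matrix_inv K *v u)) / 2) / c" for u
    by (simp add: gaussian_pdf_def c_def)
  with \<open>c > 0\<close> have ln_gaussian: "ln (gaussian_pdf K u) = - (u \<bullet> (matrix_inv K *v u)) / 2 - ln c" for u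
    by (simp add: ln_div)
  have expand: "ent_integrand D (gaussian_pdf K) u
      = - (gaussian_pdf K u * (u \<bullet> (D *v u))) / 2 + gaussian_pdf K u * (u \<bullet> (matrix_inv K *v u)) / 2
        + ln c * gaussian_pdf K u" for u
    by (simp add: ent_integrand_def ln_gaussian field_simps)
  show "integrable lborel (ent_integrand D (gaussian_pdf K))"
    unfolding expand
    by (intro Bochner_Integration.integrable_add integrable_divide integrable_minus integrable_mult_right
        integrable_gaussian_pdf_quadratic_form integrable_gaussian_pdf K)
  have "integral\<^sup>L lborel (ent_integrand D (gaussian_pdf K))
      = - trace (D ** K) / 2 + trace (matrix_inv K ** K) / 2 + ln c"
    unfolding expand using K
    by (simp add: Bochner_Integration.integral_add Bochner_Integration.integrable_add integrable_minus
        integrable_gaussian_pdf_quadratic_form integral_gaussian_pdf_quadratic_form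
        integrable_gaussian_pdf integral_gaussian_pdf)
  also have "trace (matrix_inv K ** K) = real CARD('n)"
    by (simp add: posdef_matrix_inv[OF K] trace_def mat_def)
  also have "ln c = (real CARD('n) * ln (2 * pi) + ln (det K)) / 2"
    using posdef_det_pos[OF K] by (simp add: c_def ln_sqrt ln_mult ln_realpow algebra_simps)
  finally show "integral\<^sup>L lborel (ent_integrand D (gaussian_pdf K))
      = (- trace (D ** K) + ln (det K)) / 2 + real CARD('n) / 2 * (1 + ln (2 * pi))"
    by (simp add: field_simps)
qed

section \<open>Gaussian product densities in problem (P)\<close>

lemma
  fixes f :: "'a \<Rightarrow> real" and g :: "'b \<Rightarrow> real"
  assumes M: "sigma_finite_measure M" and N: "sigma_finite_measure N"
    and f: "integrable M f" and g: "integrable N g"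
  shows integrable_pair_measure_mult: "integrable (M \<Otimes>\<^sub>M N) (\<lambda>(x, y). f x * g y)"
    and integral_pair_measure_mult: "(\<integral>(x, y). f x * g y \<partial>(M \<Otimes>\<^sub>M N)) = integral\<^sup>L M f * integral\<^sup>L N g"
proof -
  interpret pair_sigma_finite M N
    using M N by (rule pair_sigma_finite.intro)
  have [measurable]: "f \<in> borel_measurable M" "g \<in> borel_measurable N"
    using f g by auto
  show int: "integrable (M \<Otimes>\<^sub>M N) (\<lambda>(x, y). f x * g y)"
    using f g by (intro Fubini_integrable) (auto simp: abs_mult)
  show "(\<integral>(x, y). f x * g y \<partial>(M \<Otimes>\<^sub>M N)) = integral\<^sup>L M f * integral\<^sup>L N g"
    using integral_fst'[OF int] by simp
qed

lemma
  fixes K :: "real^'n::finite^'n"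
  assumes K: "posdef K" and L: "posdef (mat 1 - K)"
  defines "q \<equiv> \<lambda>(u, v). gaussian_pdf K u * gaussian_pdf (mat 1 - K) v"
  shows margU_gaussian_product: "margU q = gaussian_pdf K"
    and margV_gaussian_product: "margV q = gaussian_pdf (mat 1 - K)"
    and feasibleP_gaussian_product: "feasibleP DU DV q"
proof -
  let ?L = "mat 1 - K"
  have lborel: "sigma_finite_measure (lborel :: (real^'n) measure)"
    by (rule lborel.sigma_finite_measure_axioms)
  note pair_int = integrable_pair_measure_mult[OF lborel lborel]
    and pair_eq = integral_pair_measure_mult[OF lborel lborel]
  note [measurable] = borel_measurable_gaussian_pdf[OF K] borel_measurable_gaussian_pdf[OF L]
  show margU: "margU q = gaussian_pdf K"
    by (simp add: fun_eq_iff margU_def q_def integral_gaussian_pdf[OF L])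
  show margV: "margV q = gaussian_pdf ?L"
    by (simp add: fun_eq_iff margV_def q_def integral_gaussian_pdf[OF K])
  have "joint_pdf q"
    unfolding joint_pdf_def q_def
    using gaussian_pdf_pos[OF K] gaussian_pdf_pos[OF L]
      pair_int[OF integrable_gaussian_pdf[OF K] integrable_gaussian_pdf[OF L]]
      pair_eq[OF integrable_gaussian_pdf[OF K] integrable_gaussian_pdf[OF L]]
    by (auto simp: integral_gaussian_pdf K L less_imp_le split: prod.splits)
  moreover have "integrable (lborel \<Otimes>\<^sub>M lborel) (\<lambda>(u, v). q (u, v) * (u$i * u$j + v$i * v$j))
      \<and> (\<integral>(u, v). q (u, v) * (u$i * u$j + v$i * v$j) \<partial>(lborel \<Otimes>\<^sub>M lborel)) = (if i = j then 1 else 0)" for i j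
  proof -
    have split: "(\<lambda>(u, v). q (u, v) * (u$i * u$j + v$i * v$j))
        = (\<lambda>x. (\<lambda>(u, v). (gaussian_pdf K u * (u$i * u$j)) * gaussian_pdf ?L v) x
             + (\<lambda>(u, v). gaussian_pdf K u * (gaussian_pdf ?L v * (v$i * v$j))) x)"
      by (auto simp: q_def fun_eq_iff algebra_simps)
    note moments = integrable_gaussian_pdf integral_gaussian_pdf
      integrable_gaussian_pdf_mult_coordinates integral_gaussian_pdf_mult_coordinates
    have "K$i$j + ?L$i$j = (if i = j then 1 else 0)"
      by (simp add: mat_def)
    then show ?thesis
      unfolding split
      by (simp add: pair_int pair_eq moments K L Bochner_Integration.integral_add)
  qed
  ultimately show "feasibleP DU DV q"
    unfolding feasibleP_def margU margV
    by (simp add: integrable_ent_integrand_gaussian_pdf K L)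
qed

lemma objP_gaussian_marginals:
  fixes K :: "real^'n::finite^'n"
  assumes q: "feasibleP DU DV q" and K: "posdef K" and L: "posdef (mat 1 - K)"
    and U: "AE u in lborel. margU q u = gaussian_pdf K u"
    and V: "AE v in lborel. margV q v = gaussian_pdf (mat 1 - K) v"
  shows "objP DU DV lam q = objK DU DV lam K / 2 + (1 + lam) * (real CARD('n) / 2 * (1 + ln (2 * pi)))"
proof -
  have "integral\<^sup>L lborel (ent_integrand DU (margU q)) = integral\<^sup>L lborel (ent_integrand DU (gaussian_pdf K))"
    using q U integrable_ent_integrand_gaussian_pdf[OF K]
    by (intro integral_cong_AE) (auto simp: feasibleP_def ent_integrand_def elim!: AE_mp)
  moreover have "integral\<^sup>L lborel (ent_integrand DV (margV q)) = integral\<^sup>L lborel (ent_integrand DV (gaussian_pdf (mat 1 - K)))"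
    using q V integrable_ent_integrand_gaussian_pdf[OF L]
    by (intro integral_cong_AE) (auto simp: feasibleP_def ent_integrand_def elim!: AE_mp)
  ultimately have "objP DU DV lam q
      = ((- trace (DU ** K) + ln (det K)) / 2 + real CARD('n) / 2 * (1 + ln (2 * pi)))
        + lam * ((- trace (DV ** (mat 1 - K)) + ln (det (mat 1 - K))) / 2 + real CARD('n) / 2 * (1 + ln (2 * pi)))"
    by (simp add: objP_def integral_ent_integrand_gaussian_pdf K L)
  then show ?thesis
    by (simp add: objK_def algebra_simps add_divide_distrib diff_divide_distrib)
qed

theorem corollary1:
  fixes lam :: real
    and KU0 KV0 Sigma1 Sigma2 A B W1 W2 DU DV KU KV :: "real^'n^'n"
    and q :: "(real^'n) \<times> (real^'n) \<Rightarrow> real"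
  assumes "lam > 1"
    and "posdef KU0" and "posdef KV0" and "posdef Sigma1" and "posdef Sigma2"
    and "KU0 + KV0 = mat 1"
    and "A = KV0 ** matrix_inv (mat 1 + Sigma2)"
    and "W1 = KV0 - KV0 ** matrix_inv (mat 1 + Sigma2) ** KV0"
    and "B = KU0 ** matrix_inv (KU0 + Sigma1)"
    and "W2 = KU0 - KU0 ** matrix_inv (KU0 + Sigma1) ** KU0"
    and "DU = matrix_inv W2 - matrix_inv W2 ** B - transpose B ** matrix_inv W2
              + transpose B ** matrix_inv W2 ** B"
    and "DV = matrix_inv W1 - transpose A ** matrix_inv W1 - matrix_inv W1 ** A"
    and "optimalP DU DV lam q"
    and "posdef KU" and "posdef KV" and "KU + KV = mat 1"
    and "AE u in lborel. margU q u = gaussian_pdf KU u"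
    and "AE v in lborel. margV q v = gaussian_pdf KV v"
  shows "posdef KU \<and> posdef (mat 1 - KU)
         \<and> (\<forall>K. posdef K \<and> posdef (mat 1 - K) \<longrightarrow> objK DU DV lam K \<le> objK DU DV lam KU)"
proof -
  let ?C = "(1 + lam) * (real CARD('n) / 2 * (1 + ln (2 * pi)))"
  have KV: "KV = mat 1 - KU"
    using \<open>KU + KV = mat 1\<close> by (metis add_diff_cancel_left')
  have feasible: "feasibleP DU DV q" and optimal: "\<And>q'. feasibleP DU DV q' \<Longrightarrow> objP DU DV lam q' \<le> objP DU DV lam q"
    using \<open>optimalP DU DV lam q\<close> by (auto simp: optimalP_def)
  have I_minus_KU: "posdef (mat 1 - KU)"
    using \<open>posdef KV\<close> by (simp add: KV)
  have obj_q: "objP DU DV lam q = objK DU DV lam KU / 2 + ?C"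
    using feasible \<open>posdef KU\<close> I_minus_KU
      \<open>AE u in lborel. margU q u = gaussian_pdf KU u\<close> \<open>AE v in lborel. margV q v = gaussian_pdf KV v\<close>
    unfolding KV by (rule objP_gaussian_marginals)
  have "objK DU DV lam K \<le> objK DU DV lam KU" if K: "posdef K" "posdef (mat 1 - K)" for K
  proof -
    define q' where "q' = (\<lambda>(u, v). gaussian_pdf K u * gaussian_pdf (mat 1 - K) v)"
    have "feasibleP DU DV q'"
      unfolding q'_def using K by (rule feasibleP_gaussian_product)
    moreover have "objP DU DV lam q' = objK DU DV lam K / 2 + ?C"
      using \<open>feasibleP DU DV q'\<close> K
      by (rule objP_gaussian_marginals) (simp_all add: q'_def margU_gaussian_product margV_gaussian_product K)
    ultimately show ?thesis
      using optimal[of q'] obj_q by simp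
  qed
  with \<open>posdef KU\<close> I_minus_KU show ?thesis
    by blast
qed

end
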